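(* Let $\Gamma=(\mathcal{P},\mathcal{L})$ be a point-line geometry all of whose geometric hyperplanes are maximal subspaces of $\Gamma$. Then, for every finite-dimensional vector space $V$ over a finite field and every projective embedding $\varepsilon:\Gamma\to\mathrm{PG}(V)$, the code $\mathcal{C}(\varepsilon(\mathcal{P}))$ is minimal.
   Context: A point-line geometry is a pair $\Gamma=(\mathcal{P},\mathcal{L})$ where $\mathcal{P}$ is a non-empty set (points) and $\mathcal{L}$ is a set of subsets of $\mathcal{P}$ (lines) such that every line contains at least two points and any two distinct points lie in at most one common line. A subspace of $\Gamma$ is a subset $X\subseteq\mathcal{P}$ (possibly empty) such that every line having more than one point in $X$ is contained in $X$. A geometric hyperplane of $\Gamma$ is a proper subset $\mathcal{H}\subsetneq\mathcal{P}$ such that every line of $\Gamma$ is either contained in $\mathcal{H}$ or meets $\mathcal{H}$ in exactly one point; it is in particular a proper subspace. It is maximal if it is maximal with respect to inclusion among all proper subspaces of $\Gamma$. A projective embedding $\varepsilon:\Gamma\to\mathrm{PG}(V)$ is an injective map from $\mathcal{P}$ to the set of points of $\mathrm{PG}(V)$ which maps every line of $\Gamma$ onto a (full) projective line of $\mathrm{PG}(V)$ and such that $\varepsilon(\mathcal{P})$ spans $\mathrm{PG}(V)$. Given a set $\Omega$ of $N$ distinct points spanning $\mathrm{PG}(V)$, with $V$ of dimension $k$ over $\mathbb{F}_q$, $\mathcal{C}(\Omega)$ denotes the $[N,k]$-linear code over $\mathbb{F}_q$ having as generator matrix a $k\times N$ matrix whose columns are coordinate vectors (with respect to a fixed basis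 of $V$) of representatives of the points of $\Omega$; it is defined up to monomial equivalence. For a codeword $c=(c_i)_{i=1}^N$ put $\mathrm{supp}(c)=\{i: c_i\neq 0\}$. A linear code $\mathcal{C}$ over $\mathbb{F}_q$ is minimal if for every non-zero $c\in\mathcal{C}$ and every $c'\in\mathcal{C}$ with $\mathrm{supp}(c')\subseteq\mathrm{supp}(c)$ there is $\lambda\in\mathbb{F}_q$ with $c'=\lambda c$. *)

theory Defs
  imports "Jordan_Normal_Form.VS_Connect"
begin

locale point_line_geometry =
  fixes P :: "'p set" and L :: "'p set set"
  assumes points_nonempty: "P \<noteq> {}"
    and lines_subset: "l \<in> L \<Longrightarrow> l \<subseteq> P"
    and two_points: "l \<in> L \<Longrightarrow> \<exists>x\<in>l. \<exists>y\<in>l. x \<noteq> y"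
    and line_unique: "\<lbrakk>x \<in> P; y \<in> P; x \<noteq> y; l \<in> L; m \<in> L; x \<in> l; y \<in> l; x \<in> m; y \<in> m\<rbrakk> \<Longrightarrow> l = m"

definition geometry_subspace :: "'p set \<Rightarrow> 'p set set \<Rightarrow> 'p set \<Rightarrow> bool" where
  "geometry_subspace P L X \<longleftrightarrow>
     X \<subseteq> P \<and> (\<forall>l\<in>L. (\<exists>x\<in>l \<inter> X. \<exists>y\<in>l \<inter> X. x \<noteq> y) \<longrightarrow> l \<subseteq> X)"

definition geometric_hyperplane :: "'p set \<Rightarrow> 'p set set \<Rightarrow> 'p set \<Rightarrow> bool" where
  "geometric_hyperplane P L H \<longleftrightarrow>
     H \<subset> P \<and> (\<forall>l\<in>L. l \<subseteq> H \<or> (\<exists>!x. x \<in> l \<inter> H))"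

definition maximal_subspace :: "'p set \<Rightarrow> 'p set set \<Rightarrow> 'p set \<Rightarrow> bool" where
  "maximal_subspace P L H \<longleftrightarrow>
     geometry_subspace P L H \<and> H \<noteq> P \<and>
     (\<forall>X. geometry_subspace P L X \<and> X \<noteq> P \<and> H \<subseteq> X \<longrightarrow> X = H)"

locale projective_space = vector_space scale
  for scale :: "'a::field \<Rightarrow> 'b::ab_group_add \<Rightarrow> 'b"
begin

text \<open>A point of \<open>PG(V)\<close> is a one-dimensional subspace of \<open>V\<close>; a line of \<open>PG(V)\<close> is
  represented by the set of all points contained in some two-dimensional subspace.\<close>

definition pg_points :: "'b set set" where
  "pg_points = {U. subspace U \<and> dim U = 1}"

definition pg_lines :: "'b set set set" where
  "pg_lines = {{p \<in> pg_points. p \<subseteq> W} | W. subspace W \<and> dim W = 2}"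

definition projective_embedding :: "'p set \<Rightarrow> 'p set set \<Rightarrow> ('p \<Rightarrow> 'b set) \<Rightarrow> bool" where
  "projective_embedding P L \<epsilon> \<longleftrightarrow>
     inj_on \<epsilon> P \<and> \<epsilon> ` P \<subseteq> pg_points \<and> (\<forall>l\<in>L. \<epsilon> ` l \<in> pg_lines) \<and>
     span (\<Union>(\<epsilon> ` P)) = UNIV"

text \<open>The matrix \<open>G\<close> arises from some ordered basis \<open>bs\<close> of \<open>V\<close>, some enumeration \<open>ps\<close> of
  the points of \<open>\<Omega>\<close> and some choice \<open>r\<close> of representative vectors. Different choices give
  monomially equivalent codes.\<close>

definition generator_matrix :: "'b set set \<Rightarrow> 'a mat \<Rightarrow> bool" where
  "generator_matrix \<Omega> G \<longleftrightarrow>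
     (\<exists>bs ps r.
        distinct bs \<and> independent (set bs) \<and> span (set bs) = UNIV \<and>
        distinct ps \<and> set ps = \<Omega> \<and>
        (\<forall>p\<in>\<Omega>. r p \<noteq> 0 \<and> span {r p} = p) \<and>
        G = mat (length bs) (length ps)
              (\<lambda>(i, j). representation (set bs) (r (ps ! j)) (bs ! i)))"

lemma pg_point_representative:
  assumes "p \<in> pg_points"
  shows "\<exists>v. v \<noteq> 0 \<and> span {v} = p"
proof -
  from assms have p: "subspace p" "dim p = 1" by (auto simp: pg_points_def)
  obtain B where B: "B \<subseteq> p" "independent B" "p \<subseteq> span B" "card B = dim p"
    using basis_exists by blast
  then obtain v where "B = {v}" using p(2) by (metis card_1_singletonE)
  with B p show ?thesis
    by (metis dependent_single span_subspace)
qed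

lemma generator_matrix_exists:
  assumes "finite B" "span B = UNIV" "finite \<Omega>" "\<Omega> \<subseteq> pg_points"
  shows "\<exists>G. generator_matrix \<Omega> G"
proof -
  obtain B' where B': "B' \<subseteq> B" "independent B'" "span B' = UNIV"
    using maximal_independent_subset[of B] assms(2) span_minimal subspace_span
    by (metis top.extremum_uniqueI)
  obtain bs where bs: "set bs = B'" "distinct bs"
    using finite_distinct_list finite_subset[OF B'(1) assms(1)] by blast
  obtain ps where ps: "set ps = \<Omega>" "distinct ps"
    using finite_distinct_list assms(3) by blast
  have "\<forall>p\<in>\<Omega>. \<exists>v. v \<noteq> 0 \<and> span {v} = p"
    using assms(4) pg_point_representative by blast
  then obtain r where "\<forall>p\<in>\<Omega>. r p \<noteq> 0 \<and> span {r p} = p" by metis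
  with bs ps show ?thesis
    unfolding generator_matrix_def using B' by blast
qed

end

text \<open>Codes of length \<open>n\<close> are sets of vectors from \<^term>\<open>carrier_vec n\<close>.\<close>

definition linear_code :: "nat \<Rightarrow> 'q::field vec set \<Rightarrow> bool" where
  "linear_code n C \<longleftrightarrow> VectorSpace.subspace class_ring C (module_vec TYPE('q) n)"

definition matrix_code :: "'q::field mat \<Rightarrow> 'q vec set" where
  "matrix_code G = vec_space.row_space (dim_col G) G"

definition supp :: "'q::zero vec \<Rightarrow> nat set" where
  "supp c = {i. i < dim_vec c \<and> c $ i \<noteq> 0}"

definition minimal_code :: "nat \<Rightarrow> 'q::field vec set \<Rightarrow> bool" where
  "minimal_code n C \<longleftrightarrow>
     linear_code n C \<and>
     (\<forall>c\<in>C. c \<noteq> 0\<^sub>v n \<longrightarrow>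
        (\<forall>c'\<in>C. supp c' \<subseteq> supp c \<longrightarrow> (\<exists>k. c' = k \<cdot>\<^sub>v c)))"

end

theory Submission
  imports Defs
begin

text \<open>A codeword records the values of a linear functional \<open>f\<close> on representatives of the
  points of \<open>\<epsilon>(P)\<close> (\<open>matrix_code_functionals\<close>), so its support is the complement of the set
  \<open>H(f)\<close> of points of the geometry on which \<open>f\<close> vanishes. A line of the geometry is mapped onto
  a full projective line, which either lies in the kernel of \<open>f\<close> or meets it in exactly one
  point. Hence \<open>H(f)\<close> is a geometric hyperplane whenever it is not the whole point set
  (\<open>vanishing_points_hyperplane\<close>), and it is a subspace in any case
  (\<open>vanishing_points_subspace\<close>).

  Let \<open>c\<close> be a non-zero codeword, given by \<open>f\<close>, and let \<open>c'\<close>, given by \<open>g\<close>, have its support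
  inside that of \<open>c\<close>, so that \<open>H(f) \<subseteq> H(g)\<close>. Choose a point \<open>x\<close> outside \<open>H(f)\<close> and the scalar
  \<open>k\<close> for which \<open>g - k f\<close> vanishes at \<open>x\<close>. The subspace \<open>H(g - k f)\<close> contains \<open>H(f)\<close> and also
  \<open>x\<close>, so it exceeds the geometric hyperplane \<open>H(f)\<close>. By maximality of the latter it
  is the whole point set, which says that \<open>c' = k c\<close>.\<close>

section \<open>Spanning projective lines\<close>

locale finite_dimensional_projective_space =
  projective_space scale + finite_dimensional_vector_space scale Basis
  for scale :: "'a::field \<Rightarrow> 'b::ab_group_add \<Rightarrow> 'b" and Basis :: "'b set"
begin

lemma span_nonzero_is_pg_point:
  assumes "v \<noteq> 0"
  shows "span {v} \<in> pg_points"
proof -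
  have "independent {v}" using assms by (simp add: dependent_single)
  then have "dim (span {v}) = card {v}" by (rule dim_span_eq_card_independent)
  then show ?thesis by (simp add: pg_points_def)
qed

text \<open>Two distinct points of \<open>PG(V)\<close> span a space of dimension 2, which fills any plane of \<open>V\<close>
  that contains them.\<close>

lemma distinct_pg_points_span_plane:
  assumes W: "subspace W" "dim W = 2"
    and u: "u \<noteq> 0" "u \<in> W" and v: "v \<noteq> 0" "v \<in> W"
    and ne: "span {u} \<noteq> span {v}"
  shows "v \<notin> span {u}" and "W = span {u, v}"
proof -
  show *: "v \<notin> span {u}"
  proof
    assume "v \<in> span {u}"
    then have "span {v} \<subseteq> span {u}" by (simp add: span_minimal)
    moreover have "dim (span {u}) = 1" "dim (span {v}) = 1"
      using span_nonzero_is_pg_point u v by (auto simp: pg_points_def)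
    ultimately show False
      using subspace_dim_equal[of "span {v}" "span {u}"] ne by simp
  qed
  then have "v \<noteq> u" using span_base[of u "{u}"] by auto
  have "independent {v, u}"
    using * u by (intro independent_insertI) (auto simp: independent_empty)
  then have "W \<subseteq> span {v, u}"
    using card_ge_dim_independent[of "{v, u}" W] u v W \<open>v \<noteq> u\<close> by simp
  moreover have "span {v, u} \<subseteq> W" using u v W by (simp add: span_minimal)
  ultimately show "W = span {u, v}" by (simp add: insert_commute)
qed

text \<open>This is where fullness enters: the image of a line consists of all the points of \<open>PG(V)\<close> in
  the span of any two of its points. The subspace property uses that nothing lies outside this
  span, the existence of zeros on a line that nothing in it is missed.\<close>

lemma embedded_line_spanned:
  assumes emb: "projective_embedding P L \<epsilon>"
    and l: "l \<in> L" "l \<subseteq> P" and xy: "x \<in> l" "y \<in> l" "x \<noteq> y"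
  obtains u v where "\<epsilon> x = span {u}" "\<epsilon> y = span {v}" "v \<notin> span {u}"
    "\<epsilon> ` l = {p \<in> pg_points. p \<subseteq> span {u, v}}"
proof -
  from emb l(1) have "\<epsilon> ` l \<in> pg_lines" by (simp add: projective_embedding_def)
  then obtain W where W: "subspace W" "dim W = 2" "\<epsilon> ` l = {p \<in> pg_points. p \<subseteq> W}"
    by (auto simp: pg_lines_def)
  then have pts: "\<epsilon> x \<in> pg_points" "\<epsilon> x \<subseteq> W" "\<epsilon> y \<in> pg_points" "\<epsilon> y \<subseteq> W"
    using xy by auto
  then obtain u v where u: "u \<noteq> 0" "span {u} = \<epsilon> x" and v: "v \<noteq> 0" "span {v} = \<epsilon> y"
    using pg_point_representative by metis
  have "\<epsilon> x \<noteq> \<epsilon> y"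
    using emb l(2) xy by (metis projective_embedding_def inj_onD subsetD)
  moreover have "u \<in> W" "v \<in> W" using pts u v span_base[of u "{u}"] span_base[of v "{v}"] by auto
  ultimately have "v \<notin> span {u}" and eq: "W = span {u, v}"
    using distinct_pg_points_span_plane[OF W(1,2) u(1) _ v(1)] by (simp_all add: u(2) v(2))
  then show thesis
    using that[OF u(2)[symmetric] v(2)[symmetric]] W(3) unfolding eq by simp
qed

section \<open>Zeros of linear functionals on the geometry\<close>

definition vanishing_points :: "'p set \<Rightarrow> ('p \<Rightarrow> 'b set) \<Rightarrow> ('b \<Rightarrow> 'a) \<Rightarrow> 'p set" where
  "vanishing_points P \<epsilon> f = {x \<in> P. \<forall>v\<in>\<epsilon> x. f v = 0}"

lemma vanishes_on_point_iff:
  assumes f: "Vector_Spaces.linear scale (*) f" and "span {v} = p"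
  shows "(\<forall>u\<in>p. f u = 0) \<longleftrightarrow> f v = 0"
proof -
  interpret f: Vector_Spaces.linear scale "(*)" f by (rule f)
  show ?thesis
    using assms(2) f.eq_0_on_span[of "{v}"] span_base[of v "{v}"] by auto
qed

text \<open>A functional with zeros at two points of a line vanishes on the plane that they span, and so on
  every other point of that line.\<close>

lemma vanishing_points_subspace:
  assumes "point_line_geometry P L" and emb: "projective_embedding P L \<epsilon>"
    and f: "Vector_Spaces.linear scale (*) f"
  shows "geometry_subspace P L (vanishing_points P \<epsilon> f)"
proof -
  interpret point_line_geometry P L by fact
  interpret f: Vector_Spaces.linear scale "(*)" f by (rule f)
  have "z \<in> vanishing_points P \<epsilon> f"
    if l: "l \<in> L" and z: "z \<in> l" and xy: "x \<in> l" "y \<in> l" "x \<noteq> y"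
      and H: "x \<in> vanishing_points P \<epsilon> f" "y \<in> vanishing_points P \<epsilon> f" for l x y z
  proof -
    obtain u v where uv: "\<epsilon> x = span {u}" "\<epsilon> y = span {v}"
      "\<epsilon> ` l = {p \<in> pg_points. p \<subseteq> span {u, v}}"
      using embedded_line_spanned[OF emb l lines_subset[OF l] xy] by metis
    have "f u = 0" "f v = 0"
      using H uv vanishes_on_point_iff[OF f] by (auto simp: vanishing_points_def)
    then have "f w = 0" if "w \<in> span {u, v}" for w
      using f.eq_0_on_span[of "{u, v}"] that by auto
    then show ?thesis using z uv(3) lines_subset[OF l] by (auto simp: vanishing_points_def)
  qed
  moreover have "vanishing_points P \<epsilon> f \<subseteq> P" by (auto simp: vanishing_points_def)
  ultimately show ?thesis
    unfolding geometry_subspace_def by blast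
qed

text \<open>A functional on a plane has a non-zero kernel vector. It represents a point of the projective
  line, which is the image of a point of the geometry because the embedding is onto this line.\<close>

lemma line_meets_vanishing_points:
  assumes "point_line_geometry P L" and emb: "projective_embedding P L \<epsilon>"
    and f: "Vector_Spaces.linear scale (*) f" and l: "l \<in> L"
  shows "\<exists>z\<in>l. z \<in> vanishing_points P \<epsilon> f"
proof -
  interpret point_line_geometry P L by fact
  interpret f: Vector_Spaces.linear scale "(*)" f by (rule f)
  obtain x y where xy: "x \<in> l" "y \<in> l" "x \<noteq> y" using two_points[OF l] by blast
  obtain u v where uv: "\<epsilon> x = span {u}" "v \<notin> span {u}"
      "\<epsilon> ` l = {p \<in> pg_points. p \<subseteq> span {u, v}}"
    using embedded_line_spanned[OF emb l lines_subset[OF l] xy] by metis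
  show ?thesis
  proof (cases "f u = 0")
    case True
    then show ?thesis
      using vanishes_on_point_iff[OF f uv(1)[symmetric]] xy(1) lines_subset[OF l]
      unfolding vanishing_points_def by blast
  next
    case False
    \<comment> \<open>the combination of \<open>v\<close> and \<open>u\<close> that lies in the kernel of \<open>f\<close>; it is non-zero because
      \<open>v\<close> is not a multiple of \<open>u\<close>\<close>
    define w where "w = v - scale (f v / f u) u"
    have "w \<noteq> 0"
    proof
      assume "w = 0"
      then have "v = scale (f v / f u) u" by (simp add: w_def)
      moreover have "scale (f v / f u) u \<in> span {u}" by (intro span_scale span_base) simp
      ultimately show False using uv(2) by argo
    qed
    have "w \<in> span {u, v}" unfolding w_def by (intro span_diff span_scale span_base) auto
    then have "span {w} \<in> \<epsilon> ` l"
      using uv(3) span_nonzero_is_pg_point[OF \<open>w \<noteq> 0\<close>] by (simp add: span_minimal)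
    then obtain z where z: "z \<in> l" "\<epsilon> z = span {w}" by auto
    have "f w = 0" using False by (simp add: w_def f.diff f.scale)
    then show ?thesis
      using z(1) vanishes_on_point_iff[OF f z(2)[symmetric]] lines_subset[OF l]
      unfolding vanishing_points_def by blast
  qed
qed

text \<open>Every line has a zero of \<open>f\<close>, and a line with two of them consists of zeros, so these two facts
  together are the hyperplane condition.\<close>

lemma vanishing_points_hyperplane:
  assumes geo: "point_line_geometry P L" and emb: "projective_embedding P L \<epsilon>"
    and f: "Vector_Spaces.linear scale (*) f"
    and proper: "vanishing_points P \<epsilon> f \<noteq> P"
  shows "geometric_hyperplane P L (vanishing_points P \<epsilon> f)"
proof -
  note sub = vanishing_points_subspace[OF geo emb f]
  note meet = line_meets_vanishing_points[OF geo emb f]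
  have "vanishing_points P \<epsilon> f \<subset> P" using proper by (auto simp: vanishing_points_def)
  moreover have "l \<subseteq> vanishing_points P \<epsilon> f \<or> (\<exists>!x. x \<in> l \<inter> vanishing_points P \<epsilon> f)"
    if "l \<in> L" for l
    using sub meet[OF that] that unfolding geometry_subspace_def by blast
  ultimately show ?thesis by (simp add: geometric_hyperplane_def)
qed

text \<open>The heart of the argument: a suitable combination \<open>g - k f\<close> vanishes on the hyperplane of \<open>f\<close>
  and at one further point, and maximality of the hyperplane then forces it to vanish at every
  point of the geometry.\<close>

lemma proportional_of_vanishing_subset:
  assumes geo: "point_line_geometry P L" and emb: "projective_embedding P L \<epsilon>"
    and hyp: "\<And>H. geometric_hyperplane P L H \<Longrightarrow> maximal_subspace P L H"
    and f: "Vector_Spaces.linear scale (*) f" and g: "Vector_Spaces.linear scale (*) g"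
    and proper: "vanishing_points P \<epsilon> f \<noteq> P"
    and sub: "vanishing_points P \<epsilon> f \<subseteq> vanishing_points P \<epsilon> g"
  shows "\<exists>k. \<forall>x\<in>P. \<forall>v\<in>\<epsilon> x. g v = k * f v"
proof -
  interpret f: Vector_Spaces.linear scale "(*)" f by (rule f)
  interpret g: Vector_Spaces.linear scale "(*)" g by (rule g)
  obtain x where x: "x \<in> P" "x \<notin> vanishing_points P \<epsilon> f"
    using proper by (auto simp: vanishing_points_def)
  have "\<epsilon> x \<in> pg_points" using emb x by (auto simp: projective_embedding_def)
  then obtain v where v: "span {v} = \<epsilon> x" using pg_point_representative by blast
  have fv: "f v \<noteq> 0"
    using x vanishes_on_point_iff[OF f v] by (auto simp: vanishing_points_def)
  define k where "k = g v / f v"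
  define h where "h = (\<lambda>w. g w - k * f w)"
  have h: "Vector_Spaces.linear scale (*) h"
    unfolding Vector_Spaces.linear_iff
  proof (intro conjI allI)
    show "vector_space scale" "vector_space ((*) :: 'a \<Rightarrow> 'a \<Rightarrow> 'a)"
      using f by (simp_all add: Vector_Spaces.linear_iff)
    show "h (a + b) = h a + h b" for a b
      unfolding h_def f.add g.add by (simp add: distrib_left)
    show "h (scale c a) = c * h a" for c a
      unfolding h_def f.scale g.scale by (simp add: right_diff_distrib mult.left_commute)
  qed
  have "h v = 0" using fv by (simp add: h_def k_def)
  then have "x \<in> vanishing_points P \<epsilon> h"
    using x vanishes_on_point_iff[OF h v] by (auto simp: vanishing_points_def)
  moreover have "vanishing_points P \<epsilon> f \<subseteq> vanishing_points P \<epsilon> h"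
    using sub by (auto simp: vanishing_points_def h_def subset_iff)
  ultimately have "vanishing_points P \<epsilon> h = P"
    using hyp[OF vanishing_points_hyperplane[OF geo emb f proper]] x(2)
      vanishing_points_subspace[OF geo emb h]
    unfolding maximal_subspace_def by blast
  then show ?thesis by (force simp: vanishing_points_def h_def)
qed

section \<open>Codewords as linear functionals\<close>

lemma linear_coordinate_combination:
  assumes "independent (set bs)" "span (set bs) = UNIV"
  shows "Vector_Spaces.linear scale (*)
    (\<lambda>v. \<Sum>i<length bs. representation (set bs) v (bs ! i) * a $ i)"
proof -
  have "vector_space ((*) :: 'a \<Rightarrow> 'a \<Rightarrow> 'a)"
    by unfold_locales (auto simp: algebra_simps)
  then show ?thesis
    unfolding Vector_Spaces.linear_iff using vector_space_axioms assms
    by (auto simp: representation_add representation_scale sum.distrib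
      sum_distrib_left algebra_simps)
qed

text \<open>The columns of \<open>G\<close> hold the coordinates of the representatives. A combination of the rows
  applies one and the same linear combination of coordinates to every column, and coordinates
  are linear functionals.\<close>

lemma matrix_code_functionals:
  assumes "independent (set bs)" "span (set bs) = UNIV"
    and G: "G = mat (length bs) (length ps)
      (\<lambda>(i, j). representation (set bs) (r (ps ! j)) (bs ! i))"
    and c: "c \<in> matrix_code G"
  obtains f where "Vector_Spaces.linear scale (*) f"
    "c = vec (length ps) (\<lambda>j. f (r (ps ! j)))"
proof -
  obtain a where a: "a \<in> carrier_vec (dim_row G)" "c = G\<^sup>T *\<^sub>v a"
    using c vec_space.row_space_eq[of G "dim_row G" "dim_col G"]
    by (auto simp: matrix_code_def)
  let ?f = "\<lambda>v. \<Sum>i<length bs. representation (set bs) v (bs ! i) * a $ i"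
  have "c = vec (length ps) (\<lambda>j. ?f (r (ps ! j)))"
    using a by (intro eq_vecI) (auto simp: G scalar_prod_def atLeast0LessThan)
  then show thesis by (rule that[OF linear_coordinate_combination[OF assms(1,2)]])
qed

end

lemma linear_code_matrix_code: "linear_code (dim_col G) (matrix_code G)"
proof -
  interpret vec_space "TYPE('a)" "dim_col G" .
  have "set (rows G) \<subseteq> carrier_vec (dim_col G)" by (auto simp: rows_def)
  then show ?thesis
    unfolding linear_code_def matrix_code_def row_space_def
    using span_is_subspace by simp
qed

theorem corollary1p2:
  fixes P :: "'p set" and L :: "'p set set"
    and scale :: "'q::{field,finite} \<Rightarrow> 'v::ab_group_add \<Rightarrow> 'v"
    and Basis :: "'v set"
    and \<epsilon> :: "'p \<Rightarrow> 'v set"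
    and G :: "'q mat"
  assumes "point_line_geometry P L"
    and "\<And>H. geometric_hyperplane P L H \<Longrightarrow> maximal_subspace P L H"
    and "finite_dimensional_vector_space scale Basis"
    and "projective_space.projective_embedding scale P L \<epsilon>"
    and "projective_space.generator_matrix scale (\<epsilon> ` P) G"
  shows "minimal_code (dim_col G) (matrix_code G)"
proof -
  interpret V: finite_dimensional_vector_space scale Basis by fact
  interpret V: finite_dimensional_projective_space scale Basis
    by unfold_locales
  obtain bs ps r where B: "V.independent (set bs)" "V.span (set bs) = UNIV"
    and ps: "set ps = \<epsilon> ` P"
    and r: "\<And>p. p \<in> \<epsilon> ` P \<Longrightarrow> V.span {r p} = p"
    and G: "G = mat (length bs) (length ps)
      (\<lambda>(i, j). V.representation (set bs) (r (ps ! j)) (bs ! i))"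
    using assms(5) unfolding V.generator_matrix_def by blast
  note codeword = V.matrix_code_functionals[OF B G]
  have "\<exists>k. c' = k \<cdot>\<^sub>v c"
    if c: "c \<in> matrix_code G" "c \<noteq> 0\<^sub>v (dim_col G)"
      and c': "c' \<in> matrix_code G" "supp c' \<subseteq> supp c" for c c'
  proof -
    obtain f where f: "Vector_Spaces.linear scale (*) f"
      and cf: "c = vec (length ps) (\<lambda>j. f (r (ps ! j)))"
      using codeword[OF c(1)] .
    obtain g where g: "Vector_Spaces.linear scale (*) g"
      and cg: "c' = vec (length ps) (\<lambda>j. g (r (ps ! j)))"
      using codeword[OF c'(1)] .
    have rep: "r p \<in> p" if "p \<in> \<epsilon> ` P" for p
      using r[OF that] V.span_base[of "r p" "{r p}"] by auto
    have vanish: "x \<in> V.vanishing_points P \<epsilon> h \<longleftrightarrow> x \<in> P \<and> h (r (\<epsilon> x)) = 0"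
      if "Vector_Spaces.linear scale (*) h" for h x
      using V.vanishes_on_point_iff[OF that r] by (auto simp: V.vanishing_points_def)
    have "V.vanishing_points P \<epsilon> f \<noteq> P"
    proof
      assume "V.vanishing_points P \<epsilon> f = P"
      then have "f (r p) = 0" if "p \<in> set ps" for p
        using that vanish[OF f] unfolding ps by auto
      then have "c = 0\<^sub>v (dim_col G)" by (intro eq_vecI) (auto simp: cf G)
      then show False using c by simp
    qed
    moreover have "V.vanishing_points P \<epsilon> f \<subseteq> V.vanishing_points P \<epsilon> g"
    proof
      fix x assume x: "x \<in> V.vanishing_points P \<epsilon> f"
      then have "\<epsilon> x \<in> set ps" using ps vanish[OF f] by auto
      then obtain j where j: "j < length ps" "ps ! j = \<epsilon> x" by (auto simp: in_set_conv_nth)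
      then have "j \<notin> supp c" using x vanish[OF f] by (simp add: supp_def cf)
      then have "j \<notin> supp c'" using c' by auto
      then show "x \<in> V.vanishing_points P \<epsilon> g"
        using j x vanish[OF f] vanish[OF g] by (simp add: supp_def cg)
    qed
    ultimately obtain k where k: "\<And>x v. x \<in> P \<Longrightarrow> v \<in> \<epsilon> x \<Longrightarrow> g v = k * f v"
      using V.proportional_of_vanishing_subset[OF assms(1,4,2) f g] by metis
    have "g (r p) = k * f (r p)" if "p \<in> set ps" for p
      using that k rep unfolding ps by blast
    then have "c' = k \<cdot>\<^sub>v c" by (intro eq_vecI) (auto simp: cf cg)
    then show ?thesis ..
  qed
  then show ?thesis by (auto simp: minimal_code_def linear_code_matrix_code)
qed

end
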